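(* Let $m\ge 3$, $n\ge 1$ and $t\ge 1$ be integers. If $2(m-2)n^2+t(m-4)^2$ is a prime number, then the system $$a+b=n,\qquad ab=t\,P(m,c)$$ has no solution with $a,b$ positive integers and $c$ an admissible index (a positive integer if $m\in\{3,4\}$, an arbitrary integer if $m>4$).
   Context: For an integer $m\ge 3$, $P(m,c)=\frac{c}{2}\{(m-2)c-(m-4)\}$ denotes the $c$-th $m$-gonal number. So that $c\mapsto P(m,c)$ is injective, $c$ ranges over positive integers when $m=3$ or $m=4$, and over all integers when $m>4$. *)

theory Defs
  imports Complex_Main "HOL-Computational_Algebra.Primes"
begin

(* The integer division is exact, see two_mult_polygonal below. *)
definition polygonal :: "int \<Rightarrow> int \<Rightarrow> int" where
  "polygonal m c = (c * ((m - 2) * c - (m - 4))) div 2"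

lemma two_mult_polygonal:
  "2 * polygonal m c = c * ((m - 2) * c - (m - 4))"
proof -
  have "even (c * ((m - 2) * c - (m - 4)))"
    by auto
  then show ?thesis
    unfolding polygonal_def by (rule dvd_mult_div_cancel)
qed

lemma of_int_polygonal:
  "(of_int (polygonal m c) :: rat)
     = of_int c / 2 * ((of_int m - 2) * of_int c - (of_int m - 4))"
proof -
  have "(of_int (2 * polygonal m c) :: rat) = of_int (c * ((m - 2) * c - (m - 4)))"
    by (simp only: two_mult_polygonal)
  then show ?thesis
    by (simp add: field_simps)
qed

(* Indices c of m-gonal numbers, for m \<ge> 3, restricted so that polygonal m is injective on them. *)
definition admissible_index :: "int \<Rightarrow> int \<Rightarrow> bool" where
  "admissible_index m c \<longleftrightarrow> (if m = 3 \<or> m = 4 then c > 0 else True)"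

end

(* If a, b, c solve the system, then with A = 2(m - 2) the prime p = A n^2 + t (m - 4)^2 also equals
   A (a - b)^2 + t (2(m - 2)c - (m - 4))^2. A prime has at most one representation by a diagonal
   form A x^2 + B y^2 with A B > 1, up to signs, so (a - b)^2 = n^2 = (a + b)^2, that is, a b = 0. *)
theory Submission
  imports Defs
begin

text \<open>Composing the two representations by Brahmagupta's identity, with either sign, writes
  \<open>p\<^sup>2\<close> as \<open>z\<^sup>2 + A * B * w\<^sup>2\<close> in two ways. Primality
  makes \<open>p\<close> divide one of the two values of \<open>w\<close>, and
  \<open>A * B > 1\<close> then forces that \<open>w\<close> to be 0.\<close>

lemma prime_diagonal_form_unique:
  fixes A B u v x y p :: int
  assumes p: "prime p" and A: "A > 0" and AB: "A * B > 1" and ndvd: "\<not> p dvd A"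
    and uv: "p = A * u\<^sup>2 + B * v\<^sup>2" and xy: "p = A * x\<^sup>2 + B * y\<^sup>2"
  shows "x\<^sup>2 = u\<^sup>2" and "y\<^sup>2 = v\<^sup>2"
proof -
  have p0: "p > 0"
    using p by (rule prime_gt_0_int)
  \<comment> \<open>Cross-multiplying by \<open>y\<^sup>2\<close> and \<open>v\<^sup>2\<close>
    cancels the terms in \<open>B\<close>; the two factors left beside \<open>A\<close> are the
    values of \<open>w\<close> in the composition.\<close>
  have diff: "p * (y\<^sup>2 - v\<^sup>2) = A * ((u * y - x * v) * (u * y + x * v))"
  proof -
    have "p * y\<^sup>2 - p * v\<^sup>2 = (A * u\<^sup>2 + B * v\<^sup>2) * y\<^sup>2 - (A * x\<^sup>2 + B * y\<^sup>2) * v\<^sup>2"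
      using uv xy by simp
    then show ?thesis
      by (simp add: algebra_simps power2_eq_square)
  qed
  \<comment> \<open>For a nonzero multiple \<open>w\<close> of \<open>p\<close>, the term
    \<open>A * B * w\<^sup>2\<close> alone would exceed \<open>p\<^sup>2\<close>.\<close>
  have vanish: "w = 0" if "p dvd w" and "p\<^sup>2 = z\<^sup>2 + A * B * w\<^sup>2" for w z :: int
  proof (rule ccontr)
    assume "w \<noteq> 0"
    with that(1) have "\<bar>p\<bar> \<le> \<bar>w\<bar>"
      by (simp add: dvd_imp_le_int)
    then have "p\<^sup>2 \<le> w\<^sup>2"
      by (simp add: abs_le_square_iff)
    also have "w\<^sup>2 < A * B * w\<^sup>2"
      using AB \<open>w \<noteq> 0\<close> by simp
    finally show False
      using that(2) zero_le_power2[of z] by linarith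
  qed
  have brahmagupta: "p\<^sup>2 = (A * u * x + B * v * y)\<^sup>2 + A * B * (u * y - x * v)\<^sup>2"
    "p\<^sup>2 = (A * u * x - B * v * y)\<^sup>2 + A * B * (u * y + x * v)\<^sup>2"
  proof -
    have sq: "p\<^sup>2 = (A * u\<^sup>2 + B * v\<^sup>2) * (A * x\<^sup>2 + B * y\<^sup>2)"
      using uv xy by (metis power2_eq_square)
    show "p\<^sup>2 = (A * u * x + B * v * y)\<^sup>2 + A * B * (u * y - x * v)\<^sup>2"
      "p\<^sup>2 = (A * u * x - B * v * y)\<^sup>2 + A * B * (u * y + x * v)\<^sup>2"
      unfolding sq by algebra+
  qed
  have "p dvd (u * y - x * v) * (u * y + x * v)"
    using diff p ndvd by (metis dvd_triv_left prime_dvd_mult_iff)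
  then have "p dvd u * y - x * v \<or> p dvd u * y + x * v"
    using p by (simp add: prime_dvd_mult_iff)
  then have "(u * y - x * v) * (u * y + x * v) = 0"
    using vanish brahmagupta by (metis mult_zero_left mult_zero_right)
  with diff p0 show y: "y\<^sup>2 = v\<^sup>2"
    by simp
  have "A * x\<^sup>2 = A * u\<^sup>2"
    using uv xy y by simp
  with A show "x\<^sup>2 = u\<^sup>2"
    by simp
qed

theorem theorem1:
  fixes m n t :: int
  assumes "m \<ge> 3" and "n \<ge> 1" and "t \<ge> 1"
    and "prime (2 * (m - 2) * n\<^sup>2 + t * (m - 4)\<^sup>2)"
  shows "\<nexists>a b c :: int. a > 0 \<and> b > 0 \<and> admissible_index m c
           \<and> a + b = n \<and> a * b = t * polygonal m c"
proof
  define A where "A = 2 * (m - 2)"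
  define p where "p = A * n\<^sup>2 + t * (m - 4)\<^sup>2"
  assume "\<exists>a b c :: int. a > 0 \<and> b > 0 \<and> admissible_index m c
           \<and> a + b = n \<and> a * b = t * polygonal m c"
  then obtain a b c :: int where ab: "a > 0" "b > 0" "a + b = n" "a * b = t * polygonal m c"
    by blast
  have p: "prime p"
    using assms(4) by (simp add: p_def A_def)
  have A: "A \<ge> 2"
    using assms(1) by (simp add: A_def)
  have "A * t > 1"
    using A assms(3) mult_mono[of 2 A 1 t] by simp
  \<comment> \<open>Positivity of both \<open>a\<close> and \<open>b\<close> gives
    \<open>n \<ge> 2\<close>, which makes \<open>p\<close> strictly larger than
    \<open>A\<close>.\<close>
  moreover have "\<not> p dvd A"
  proof -
    have "n\<^sup>2 \<ge> 2\<^sup>2"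
      using ab by (intro power_mono) auto
    then have "A * n\<^sup>2 > A"
      using A by simp
    moreover have "t * (m - 4)\<^sup>2 \<ge> 0"
      using assms(3) by simp
    ultimately have "A < p"
      by (simp add: p_def)
    then show ?thesis
      using A zdvd_not_zless by simp
  qed
  \<comment> \<open>Replace \<open>n\<^sup>2\<close> by \<open>(a - b)\<^sup>2 + 4 * a * b\<close>.
    The term \<open>4 * A * a * b\<close> equals \<open>t * (A * c) * (A * c - 2 * (m - 4))\<close>,
    and adding \<open>t * (m - 4)\<^sup>2\<close> completes the square in
    \<open>A * c\<close>.\<close>
  moreover have "p = A * (a - b)\<^sup>2 + t * (A * c - (m - 4))\<^sup>2"
  proof -
    have "2 * (a * b) = t * (c * ((m - 2) * c - (m - 4)))"
      using ab(4) two_mult_polygonal[of m c] by (metis mult.left_commute)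
    then show ?thesis
      unfolding p_def A_def ab(3)[symmetric] by algebra
  qed
  ultimately have "(a - b)\<^sup>2 = n\<^sup>2"
    using p A p_def by (intro prime_diagonal_form_unique(1)[of p A t n "m - 4"]) auto
  then have "a * b = 0"
    unfolding ab(3)[symmetric] by (simp add: power2_eq_square algebra_simps)
  with ab(1,2) show False
    by simp
qed

end
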